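(* There exists a sequence $(a_n)_{n \geq 1}$ of (non-negative) integers such that $a_n = \Theta(n^{1/2})$ as $n \to \infty$ and the Rademacher random walk associated with $(a_n)_{n\ge 1}$ is weakly recurrent.
   Context: Let $\epsilon_1, \epsilon_2, \dots$ be independent Rademacher random variables, taking values $\pm 1$ each with probability $1/2$. The Rademacher random walk associated with a deterministic sequence $(a_n)_{n\ge1}$ of non-negative reals is $(X_n)_{n\ge 0}$, $X_n = \sum_{k=1}^n \epsilon_k a_k$. The walk is weakly recurrent if $\mathbb{P}(\exists C<\infty : |X_n| \le C \text{ for infinitely many } n) = 1$. The notation $a_n=\Theta(n^{1/2})$ means that there are constants $0<c\le C<\infty$ with $c\,n^{1/2}\le a_n\le C n^{1/2}$ for all sufficiently large $n$. *)

theory Defs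
  imports "HOL-Probability.Probability" "HOL-Library.Landau_Symbols"
begin

text \<open>Sequences are indexed by \<open>n \<ge> 1\<close>; the entries at index \<open>0\<close> are never used.\<close>

locale rademacher_sequence = prob_space M
  for M :: "'w measure" and \<epsilon> :: "nat \<Rightarrow> 'w \<Rightarrow> real" +
  assumes indep: "indep_vars (\<lambda>_. borel) \<epsilon> {1..}"
    and prob_pos: "k \<ge> 1 \<Longrightarrow> prob {\<omega> \<in> space M. \<epsilon> k \<omega> = 1} = 1 / 2"
    and prob_neg: "k \<ge> 1 \<Longrightarrow> prob {\<omega> \<in> space M. \<epsilon> k \<omega> = -1} = 1 / 2"

definition rademacher_walk ::
    "(nat \<Rightarrow> 'w \<Rightarrow> real) \<Rightarrow> (nat \<Rightarrow> real) \<Rightarrow> nat \<Rightarrow> 'w \<Rightarrow> real" where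
  "rademacher_walk \<epsilon> a n \<omega> = (\<Sum>k=1..n. \<epsilon> k \<omega> * a k)"

definition weakly_recurrent :: "'w measure \<Rightarrow> (nat \<Rightarrow> 'w \<Rightarrow> real) \<Rightarrow> bool" where
  "weakly_recurrent M X \<longleftrightarrow>
     measure M {\<omega> \<in> space M. \<exists>C::real. \<exists>\<^sub>\<infinity>n. \<bar>X n \<omega>\<bar> \<le> C} = 1"

text \<open>Rademacher sequences exist: take the coordinates of an infinite product of fair signs.\<close>

lemma rademacher_sequence_PiM:
  "rademacher_sequence (PiM UNIV (\<lambda>_::nat. measure_pmf (pmf_of_set {-1, 1 :: real})))
     (\<lambda>k \<omega>. \<omega> k)"
proof -
  define P where "P = measure_pmf (pmf_of_set {-1, 1 :: real})"
  define M where "M = PiM UNIV (\<lambda>_::nat. P)"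
  have P: "prob_space P" unfolding P_def by (rule measure_pmf.prob_space_axioms)
  interpret M: prob_space M unfolding M_def by (rule prob_space_PiM) (rule P)
  have mk: "(\<lambda>\<omega>. \<omega> k) \<in> M \<rightarrow>\<^sub>M P" for k
    unfolding M_def by (rule measurable_component_singleton) simp
  have d: "distr M P (\<lambda>\<omega>. \<omega> k) = P" for k
    unfolding M_def by (rule distr_PiM_component) (auto simp: P)
  have m: "(\<lambda>x. x) \<in> P \<rightarrow>\<^sub>M borel" unfolding P_def by simp
  have i0: "M.indep_vars (\<lambda>_. P) (\<lambda>k \<omega>. \<omega> k) UNIV"
    by (subst M.indep_vars_iff_distr_eq_PiM) (auto simp: mk d M_def[symmetric] restrict_def)
  have i1: "M.indep_vars (\<lambda>_. borel) (\<lambda>k \<omega>. \<omega> k) UNIV"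
    using M.indep_vars_compose2[OF i0, of "\<lambda>_ x. x" "\<lambda>_. borel"] m by simp
  have pr: "M.prob {\<omega> \<in> space M. \<omega> k = c} = 1/2" if "c \<in> {-1, 1}" for k c
  proof -
    have "M.prob {\<omega> \<in> space M. \<omega> k = c} = measure (distr M P (\<lambda>\<omega>. \<omega> k)) {c}"
      by (subst measure_distr[OF mk]) (auto simp: P_def vimage_def Int_def conj_commute)
    also have "\<dots> = 1/2" unfolding d unfolding P_def
      using that by (auto simp: measure_pmf_single)
    finally show ?thesis .
  qed
  have "rademacher_sequence M (\<lambda>k \<omega>. \<omega> k)"
    by unfold_locales (use pr M.indep_vars_subset[OF i1] in auto)
  then show ?thesis unfolding M_def P_def .
qed

end

theory Submission
  imports Defs "HOL-Library.Discrete_Functions"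
begin

text \<open>
  The walk uses, for \<open>4 ^ k \<le> n < 4 ^ Suc k\<close>, steps that alternate between \<open>s\<close> and \<open>s + 1\<close>
  with \<open>s = 2 ^ k\<close>. Such steps are of order \<open>sqrt n\<close>, so the walk is of order \<open>n\<close> at time \<open>n\<close>, and
  it is enough to show that it almost surely returns to \<open>0\<close> infinitely often.

  Within block \<open>k\<close>, the displacement after \<open>m\<close> pairs of steps is \<open>s U + (s + 1) V\<close> with independent
  simple random walks \<open>U\<close> and \<open>V\<close> of length \<open>m\<close>. The small difference of the two step sizes makes
  every integer of the right parity reachable: while \<open>m\<close> is of order \<open>s\<^sup>2\<close>, a walk that starts the
  block at distance at most \<open>K * 4 ^ k\<close> from \<open>0\<close> is at \<open>0\<close> with probability at least \<open>c / m\<close>,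
  where \<open>c\<close> depends on \<open>K\<close> only and \<open>k\<close> is large (\<open>hit_prob_ge\<close>). Hence the expected number of visits to \<open>0\<close> in the block is
  bounded below. On the other hand, a walk at \<open>0\<close> is back after \<open>m\<close> pairs with probability at most
  \<open>1 / m + 16 / s\<^sup>2\<close>, essentially because \<open>(U, V)\<close> has to return to the origin of the plane
  (\<open>return_prob_le\<close>), so that only \<open>O(k)\<close> further visits are expected in the block after the first.
  Decomposing at the first visit (\<open>visits_le\<close>) shows that the block contains a visit with probability
  at least \<open>\<delta> / (k + 1)\<close> (\<open>block_survival\<close>).

  The sum of \<open>1 / k\<close> diverges. By Chebyshev the walk is outside the range \<open>K * 4 ^ k\<close> with
  probability at most \<open>4 / K\<^sup>2\<close>, so the probability \<open>r\<close> of having avoided \<open>0\<close> from some fixed time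
  up to the start of block \<open>k\<close> drops in that block by at least \<open>\<delta> / (k + 1) * (r - 4 / K\<^sup>2)\<close>; it
  therefore ends up below every number greater than \<open>4 / K\<^sup>2\<close>, and \<open>K\<close> is arbitrary
  (\<open>survival_small\<close>).

  All of this concerns transition probabilities of a walk on \<open>\<int>\<close> and is carried out for a real-valued
  recursion, the survival expectation of a killed walk. Independence enters only at the end, when
  cylinder events identify that recursion with probabilities of the Rademacher walk
  (\<open>prob_stays_le\<close>).
\<close>

section \<open>Local estimates for the simple random walk\<close>

text \<open>
  The probability that the simple symmetric random walk on \<open>\<int>\<close>, started at \<open>0\<close>, is at
  \<open>v\<close> at time \<open>m\<close>. The recursion, rather than a binomial coefficient divided by \<open>2 ^ m\<close>, keeps
  the parity condition on \<open>m + v\<close> implicit, so that all estimates below are plain inductions.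
\<close>
primrec srw :: "nat \<Rightarrow> int \<Rightarrow> real" where
  "srw 0 v = of_bool (v = 0)"
| "srw (Suc m) v = (srw m (v - 1) + srw m (v + 1)) / 2"

lemma srw_nonneg: "0 \<le> srw m v"
  by (induction m arbitrary: v) auto

lemma srw_uminus: "srw m (- v) = srw m v"
proof (induction m arbitrary: v)
  case (Suc m)
  have "- v - 1 = - (v + 1)" "- v + 1 = - (v - 1)" by simp_all
  then have "srw m (- v - 1) = srw m (v + 1)" "srw m (- v + 1) = srw m (v - 1)"
    using Suc[of "v + 1"] Suc[of "v - 1"] by metis+
  then show ?case by simp
qed simp

lemma srw_eq_0: "\<bar>v\<bar> > int m \<Longrightarrow> srw m v = 0"
  by (induction m arbitrary: v) auto

lemma srw_odd: "odd (int m + v) \<Longrightarrow> srw m v = 0"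
  by (induction m arbitrary: v) auto

text \<open>
  The quotient of neighbouring binomial coefficients. With it the size of the central value,
  and the rate at which the distribution decays away from the centre, can be read off.
\<close>
lemma srw_ratio: "(real m + of_int v + 2) * srw m (v + 2) = (real m - of_int v) * srw m v"
proof (induction m arbitrary: v)
  case 0
  then show ?case by auto
next
  case (Suc m)
  have "(real m + of_int v + 1) * srw m (v + 1) = (real m - of_int v + 1) * srw m (v - 1)"
    using Suc[of "v - 1"] by (simp add: algebra_simps)
  moreover have "(real m + of_int v + 3) * srw m (v + 3) = (real m - of_int v - 1) * srw m (v + 1)"
    using Suc[of "v + 1"] by (simp add: algebra_simps)
  ultimately show ?case by (simp add: field_simps)
qed

lemma srw_antimono: "v \<ge> -1 \<Longrightarrow> srw m (v + 2) \<le> srw m v"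
proof (induction m arbitrary: v)
  case (Suc m)
  show ?case
  proof (cases "v = -1")
    case True
    then show ?thesis using srw_uminus[of "Suc m" 1] by (simp del: srw.simps)
  next
    case False
    then show ?thesis using Suc.IH[of "v - 1"] Suc.IH[of "v + 1"] Suc.prems
      by (simp add: algebra_simps)
  qed
qed auto

definition srw_avg :: "nat \<Rightarrow> (int \<Rightarrow> real) \<Rightarrow> real" where
  "srw_avg m g = (\<Sum>v\<in>{-int m..int m}. srw m v * g v)"

lemma srw_avg_wide:
  assumes "N \<ge> int m" "N' \<ge> int m"
  shows "(\<Sum>v\<in>{-N'..N}. srw m v * g v) = srw_avg m g"
  unfolding srw_avg_def using assms by (intro sum.mono_neutral_right) (auto simp: srw_eq_0)

lemma srw_avg_0 [simp]: "srw_avg 0 g = g 0"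
  by (simp add: srw_avg_def)

lemma srw_avg_Suc: "srw_avg (Suc m) g = (srw_avg m (\<lambda>v. g (v + 1)) + srw_avg m (\<lambda>v. g (v - 1))) / 2"
proof -
  let ?I = "{-int (Suc m)..int (Suc m)}"
  have 1: "(\<Sum>v\<in>?I. srw m (v - 1) * g v) = srw_avg m (\<lambda>v. g (v + 1))"
    unfolding srw_avg_wide[of m "int m" "int m + 2" "\<lambda>v. g (v + 1)", simplified, symmetric]
    by (rule sum.reindex_bij_witness[of _ "\<lambda>v. v + 1" "\<lambda>v. v - 1"]) auto
  have 2: "(\<Sum>v\<in>?I. srw m (v + 1) * g v) = srw_avg m (\<lambda>v. g (v - 1))"
    unfolding srw_avg_wide[of m "int m + 2" "int m" "\<lambda>v. g (v - 1)", simplified, symmetric]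
    by (rule sum.reindex_bij_witness[of _ "\<lambda>v. v - 1" "\<lambda>v. v + 1"]) auto
  show ?thesis
    unfolding 1[symmetric] 2[symmetric] unfolding srw_avg_def
    by (simp add: sum.distrib sum_divide_distrib add_divide_distrib algebra_simps)
qed

lemma srw_avg_add: "srw_avg m (\<lambda>v. g v + h v) = srw_avg m g + srw_avg m h"
  by (simp add: srw_avg_def sum.distrib algebra_simps)

lemma srw_avg_divide: "srw_avg m (\<lambda>v. g v / c) = srw_avg m g / c"
  by (simp add: srw_avg_def sum_divide_distrib)

lemma srw_avg_const [simp]: "srw_avg m (\<lambda>_. c) = c"
  by (induction m) (auto simp: srw_avg_Suc)

lemma srw_avg_point: "srw_avg m (\<lambda>v. of_bool (v = w)) = srw m w"
  by (induction m arbitrary: w) (auto simp: srw_avg_Suc algebra_simps eq_commute eq_diff_eq)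

lemma srw_antimono_add: "v \<ge> -1 \<Longrightarrow> srw m (v + 2 * int r) \<le> srw m v"
proof (induction r)
  case (Suc r)
  then show ?case using srw_antimono[of "v + 2 * int r" m] by (simp add: algebra_simps)
qed simp

text \<open>
  By unimodality the value at \<open>v > 0\<close> is at most each of the values at \<open>v - 2, v - 4, \<dots>\<close> down to
  \<open>0\<close> or \<open>1\<close>. Together with \<open>v\<close> these are more than \<open>v / 2\<close> points, and the total mass is one. Unlike
  \<open>1 / sqrt m\<close>, the bound has a square that is summable over \<open>v\<close>; this controls the event that two
  walks cancel each other far from the origin.
\<close>
lemma srw_le_inverse_abs:
  assumes "v \<noteq> 0"
  shows "srw m v \<le> 2 / \<bar>of_int v\<bar>"
proof -
  have *: "srw m (int n) \<le> 2 / real n" if "n > 0" for n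
  proof (cases "n \<le> m")
    case False
    then show ?thesis by (simp add: srw_eq_0)
  next
    case True
    define J where "J = (\<lambda>r. int n - 2 * int r) ` {..n div 2}"
    have "real n / 2 * srw m (int n) \<le> real (card J) * srw m (int n)"
    proof (intro mult_right_mono srw_nonneg)
      have "card J = n div 2 + 1"
        unfolding J_def by (subst card_image) (auto simp: inj_on_def)
      then show "real n / 2 \<le> real (card J)" by linarith
    qed
    also have "\<dots> = (\<Sum>w\<in>J. srw m (int n))" by simp
    also have "\<dots> \<le> (\<Sum>w\<in>J. srw m w)"
    proof (intro sum_mono)
      fix w assume "w \<in> J"
      then obtain r where r: "r \<le> n div 2" "w = int n - 2 * int r" by (auto simp: J_def)
      show "srw m (int n) \<le> srw m w"
        using srw_antimono_add[of w m r] r by simp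
    qed
    also have "\<dots> \<le> (\<Sum>w\<in>{-int m..int m}. srw m w)"
      using True by (intro sum_mono2) (auto simp: J_def srw_nonneg)
    also have "\<dots> = 1" using srw_avg_const[of m 1, unfolded srw_avg_def] by simp
    finally show ?thesis using that by (simp add: field_simps)
  qed
  show ?thesis
    using *[of "nat \<bar>v\<bar>"] assms srw_uminus[of m v] by (auto simp: abs_if split: if_splits)
qed

lemma srw_centre_Suc: "srw (2 * n + 1) 1 = (2 * real n + 1) / (2 * real n + 2) * srw (2 * n) 0"
proof -
  have "(2 * real n + 2) * srw (2 * n) 2 = 2 * real n * srw (2 * n) 0"
    using srw_ratio[of "2 * n" 0] by simp
  then show ?thesis by (simp add: field_simps)
qed

lemma srw_centre_even: "srw (2 * n + 2) 0 = srw (2 * n + 1) 1"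
proof -
  have "srw (2*n+1) (-1) = srw (2*n+1) 1" by (rule srw_uminus)
  moreover have "srw (2 * n + 2) 0 = (srw (2*n+1) (-1) + srw (2*n+1) 1) / 2"
    using srw.simps(2)[of "2 * n + 1" 0] by (simp del: srw.simps)
  ultimately show ?thesis by (simp only: add_divide_distrib field_sum_of_halves)
qed

text \<open>
  Wallis: \<open>w\<^sup>2 (2 n + 1)\<close> decreases and \<open>4 n w\<^sup>2\<close> increases in \<open>n\<close>, where \<open>w\<close> is the central
  probability at time \<open>2 n\<close>.
\<close>
lemma srw_centre_upper: "(srw (2 * n) 0)\<^sup>2 * (2 * real n + 1) \<le> 1"
proof (induction n)
  case (Suc n)
  let ?w = "srw (2 * n) 0"
  have "srw (2 * Suc n) 0 = (2 * real n + 1) / (2 * real n + 2) * ?w"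
    using srw_centre_even[of n] srw_centre_Suc[of n] by (simp del: srw.simps)
  then have "(srw (2 * Suc n) 0)\<^sup>2 * (2 * real (Suc n) + 1)
    = (?w\<^sup>2 * (2 * real n + 1)) * ((2 * real n + 1) * (2 * real n + 3) / (2 * real n + 2)\<^sup>2)"
    by (simp add: power2_eq_square algebra_simps del: srw.simps)
  also have "\<dots> \<le> 1 * 1"
  proof (rule mult_mono)
    show "(2 * real n + 1) * (2 * real n + 3) / (2 * real n + 2)\<^sup>2 \<le> 1"
      by (simp add: divide_le_eq power2_eq_square algebra_simps) (smt (verit) of_nat_0_le_iff mult_nonneg_nonneg)
  qed (use Suc in \<open>auto\<close>)
  finally show ?case by simp
qed simp

lemma srw_centre_lower: "n \<ge> 1 \<Longrightarrow> 1 \<le> (srw (2 * n) 0)\<^sup>2 * (4 * real n)"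
proof (induction n rule: dec_induct)
  case base
  have c: "srw (2 * 1) 0 = 1 / 2" by (simp add: numeral_2_eq_2)
  show ?case unfolding c by (simp add: power2_eq_square)
next
  case (step n)
  let ?w = "srw (2 * n) 0"
  have "srw (2 * Suc n) 0 = (2 * real n + 1) / (2 * real n + 2) * ?w"
    using srw_centre_even[of n] srw_centre_Suc[of n] by (simp del: srw.simps)
  then have "(srw (2 * Suc n) 0)\<^sup>2 * (4 * real (Suc n))
    = ((2 * real n + 1) / (2 * real n + 2))\<^sup>2 * ?w\<^sup>2 * (4 * (real n + 1))"
    by (simp add: power_mult_distrib power_divide add.commute del: srw.simps)
  also have "\<dots> = (?w\<^sup>2 * (4 * real n)) * ((2 * real n + 1)\<^sup>2 / (4 * real n * (real n + 1)))"
  proof -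
    define p where "p = real n + 1"
    have "2 * real n + 2 = 2 * p" "p > 0" "real n > 0" using step by (auto simp: p_def)
    then show ?thesis unfolding p_def[symmetric] by (simp add: power2_eq_square)
  qed
  finally have eq: "(srw (2 * Suc n) 0)\<^sup>2 * (4 * real (Suc n)) = \<dots>" .
  have "1 * 1 \<le> (?w\<^sup>2 * (4 * real n)) * ((2 * real n + 1)\<^sup>2 / (4 * real n * (real n + 1)))"
  proof (rule mult_mono)
    show "1 \<le> (2 * real n + 1)\<^sup>2 / (4 * real n * (real n + 1))"
    proof -
      have "0 < 4 * real n * (real n + 1)" using step by simp
      then show ?thesis by (simp add: pos_le_divide_eq power2_eq_square algebra_simps)
    qed
  qed (use step in \<open>auto\<close>)
  then show ?case unfolding eq by simp
qed

lemma srw_le_inverse_sqrt: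
  assumes "m \<ge> 1"
  shows "srw m v \<le> 1 / sqrt (real m)"
proof -
  have c: "srw (2 * n) 0 \<le> 1 / sqrt (2 * real n + 1)" for n
  proof -
    have "(srw (2 * n) 0)\<^sup>2 \<le> 1 / (2 * real n + 1)"
      using srw_centre_upper[of n] by (simp add: pos_le_divide_eq)
    then have "srw (2 * n) 0 \<le> sqrt (1 / (2 * real n + 1))" by (rule real_le_rsqrt)
    then show ?thesis by (simp add: real_sqrt_divide)
  qed
  have even_le: "srw (2 * n) v \<le> srw (2 * n) 0" for n v
  proof (cases "even v")
    case False
    then show ?thesis by (simp add: srw_odd srw_nonneg)
  next
    case True
    then have "\<bar>v\<bar> = 0 + 2 * int (nat (\<bar>v\<bar> div 2))" by auto
    then have "srw (2 * n) \<bar>v\<bar> \<le> srw (2 * n) 0"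
      using srw_antimono_add[of 0 "2 * n" "nat (\<bar>v\<bar> div 2)"] by simp
    then show ?thesis by (simp add: abs_if srw_uminus split: if_splits)
  qed
  have sup: "srw (2 * n) v \<le> 1 / sqrt (2 * real n + 1)" for n v
    using even_le[of n v] c[of n] by linarith
  show ?thesis
  proof (cases "even m")
    case True
    then obtain n where m: "m = 2 * n" by blast
    have "1 / sqrt (2 * real n + 1) \<le> 1 / sqrt (real m)"
      using assms by (intro divide_left_mono) (auto simp: m)
    then show ?thesis using sup[of n v] m by simp
  next
    case False
    then obtain n where m: "m = 2 * n + 1" by (blast elim: oddE)
    then have "srw m v = (srw (2 * n) (v - 1) + srw (2 * n) (v + 1)) / 2" by simp
    then show ?thesis using sup[of n "v - 1"] sup[of n "v + 1"] m by (simp add: add.commute)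
  qed
qed

lemma srw_centre_ge:
  assumes "m \<ge> 1"
  shows "srw m (int (m mod 2)) \<ge> 1 / (2 * sqrt (real m))"
proof -
  have c: "1 / (2 * sqrt (real n)) \<le> srw (2 * n) 0" if "n \<ge> 1" for n
  proof -
    have "1 / (4 * real n) \<le> (srw (2 * n) 0)\<^sup>2"
      using srw_centre_lower[OF that] that by (simp add: pos_divide_le_eq)
    then have "sqrt (1 / (4 * real n)) \<le> srw (2 * n) 0"
      by (intro real_le_lsqrt) (auto simp: srw_nonneg)
    then show ?thesis by (simp add: real_sqrt_divide real_sqrt_mult)
  qed
  show ?thesis
  proof (cases "even m")
    case True
    then obtain n where m: "m = 2 * n" by blast
    have "1 / (2 * sqrt (real m)) \<le> 1 / (2 * sqrt (real n))"
      using assms by (intro divide_left_mono) (auto simp: m)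
    then show ?thesis using c[of n] m assms by simp
  next
    case False
    then obtain n where m: "m = 2 * n + 1" by (blast elim: oddE)
    have "1 / (2 * sqrt (real m)) \<le> 1 / (2 * sqrt (real (n + 1)))"
      using assms by (intro divide_left_mono) (auto simp: m)
    also have "\<dots> \<le> srw (2 * (n + 1)) 0" by (rule c) simp
    also have "\<dots> = srw m (int (m mod 2))" using srw_centre_even[of n] m by simp
    finally show ?thesis .
  qed
qed

text \<open>
  Each step of length two away from the centre costs a factor of at least \<open>1 - 2 A / m\<close>, hence
  at least \<open>exp (- 4 A / m)\<close>, and \<open>A / 2\<close> such steps reach \<open>v\<close>. So in the range \<open>\<bar>v\<bar> = O(sqrt m)\<close>
  the probability stays of the central order \<open>1 / sqrt m\<close>.
\<close>
lemma srw_gaussian_lower: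
  fixes A :: real
  assumes "m \<ge> 1" "even (int m + v)" "\<bar>of_int v\<bar> \<le> A" "4 * A \<le> real m" "A\<^sup>2 \<le> L * real m"
  shows "srw m v \<ge> exp (- 2 * L) / (2 * sqrt (real m))"
proof -
  let ?v0 = "int (m mod 2)"
  have step: "srw m (?v0 + 2 * int r) \<ge> exp (- (4 * A / real m) * real r) * srw m ?v0"
    if "real_of_int (?v0 + 2 * int r) \<le> A" for r
    using that
  proof (induction r)
    case (Suc r)
    let ?w = "?v0 + 2 * int r" and ?y = "2 * A / real m"
    have A: "0 \<le> A" "of_int ?w + 2 \<le> A" using assms Suc.prems by auto
    have y: "0 \<le> ?y" "?y \<le> 1 / 2" using assms A by (auto simp: field_simps)
    have "exp (- 2 * ?y) \<le> 1 - ?y"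
    proof -
      have "- ?y - 2 * ?y\<^sup>2 \<le> ln (1 - ?y)" by (rule ln_one_minus_pos_lower_bound) (use y in auto)
      moreover have "2 * ?y\<^sup>2 \<le> ?y"
        using mult_left_mono[OF y(2) y(1)] by (simp add: power2_eq_square)
      ultimately have "- 2 * ?y \<le> ln (1 - ?y)" by linarith
      then have "exp (- 2 * ?y) \<le> exp (ln (1 - ?y))" by simp
      then show ?thesis using y by simp
    qed
    also have "1 - ?y \<le> (real m - of_int ?w) / (real m + of_int ?w + 2)"
    proof -
      have "(real m - of_int ?w) / (real m + of_int ?w + 2) = 1 - (2 * of_int ?w + 2) / (real m + of_int ?w + 2)"
        using assms(1) by (simp add: field_simps)
      moreover have "(2 * of_int ?w + 2) / (real m + of_int ?w + 2) \<le> ?y"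
        using assms(1) A by (intro frac_le) auto
      ultimately show ?thesis by linarith
    qed
    finally have e: "exp (- 2 * ?y) \<le> (real m - of_int ?w) / (real m + of_int ?w + 2)" .
    have "- (4 * A / real m) * real (Suc r) = - 2 * ?y + - (4 * A / real m) * real r"
      by (simp add: algebra_simps add_divide_distrib)
    then have "exp (- (4 * A / real m) * real (Suc r)) * srw m ?v0
        = exp (- 2 * ?y) * (exp (- (4 * A / real m) * real r) * srw m ?v0)"
      by (simp only: exp_add mult.assoc)
    also have "\<dots> \<le> (real m - of_int ?w) / (real m + of_int ?w + 2) * srw m ?w"
    proof (rule mult_mono[OF e])
      show "exp (- (4 * A / real m) * real r) * srw m ?v0 \<le> srw m ?w"
        by (rule Suc.IH) (use A in linarith)
      show "0 \<le> (real m - of_int ?w) / (real m + of_int ?w + 2)"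
        using exp_ge_zero e by (rule order_trans)
    qed (simp add: srw_nonneg)
    also have "\<dots> = srw m (?w + 2)"
      using srw_ratio[of m ?w] assms(1) by (simp add: field_simps)
    finally show ?case by (simp add: algebra_simps)
  qed simp
  define r where "r = nat ((\<bar>v\<bar> - ?v0) div 2)"
  have par: "even (\<bar>v\<bar> - ?v0)" using assms(2) by (cases "even m") (auto simp: odd_iff_mod_2_eq_one)
  have ge: "\<bar>v\<bar> \<ge> ?v0"
  proof (cases "even m")
    case False then have "v \<noteq> 0" "m mod 2 = 1" using assms(2) by (auto simp: odd_iff_mod_2_eq_one)
    then show ?thesis by simp
  qed (auto)
  have v: "?v0 + 2 * int r = \<bar>v\<bar>" using par ge unfolding r_def by auto
  have r: "2 * real r \<le> A"
  proof -
    have "2 * int r \<le> \<bar>v\<bar>" using v by linarith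
    then have "of_int (2 * int r) \<le> (of_int \<bar>v\<bar> :: real)" by (simp only: of_int_le_iff)
    then show ?thesis using assms(3) by simp
  qed
  have "exp (- 2 * L) / (2 * sqrt (real m)) = exp (- 2 * L) * (1 / (2 * sqrt (real m)))" by simp
  also have "\<dots> \<le> exp (- (4 * A / real m) * real r) * srw m ?v0"
  proof (intro mult_mono srw_centre_ge assms)
    have "4 * A / real m * real r = 2 * (A * (2 * real r)) / real m" by simp
    also have "\<dots> \<le> 2 * (A * A) / real m"
      using r assms(3) by (intro divide_right_mono mult_left_mono) auto
    also have "\<dots> \<le> 2 * (L * real m) / real m"
      using assms(5) by (intro divide_right_mono mult_left_mono) (auto simp: power2_eq_square)
    also have "\<dots> = 2 * L" using assms(1) by simp
    finally show "exp (- 2 * L) \<le> exp (- (4 * A / real m) * real r)" by simp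
  qed auto
  also have "\<dots> \<le> srw m \<bar>v\<bar>" using step[of r] assms(3) unfolding v by simp
  also have "\<dots> = srw m v" by (simp add: abs_if srw_uminus)
  finally show ?thesis .
qed

section \<open>Walks with varying step sizes, killed outside a set\<close>

text \<open>
  The expectation of \<open>f\<close> at the position at time \<open>n + j\<close> of the walk that sits at \<open>x\<close> at time
  \<open>n\<close>, moves by \<open>\<plusminus> b i\<close> between the times \<open>i\<close> and \<open>i + 1\<close>, and contributes nothing unless it is in
  \<open>D i\<close> at all times \<open>i\<close> with \<open>n \<le> i < n + j\<close>. With \<open>f = (\<lambda>_. 1)\<close> this is a survival probability.
\<close>
primrec killed :: "(nat \<Rightarrow> int) \<Rightarrow> (nat \<Rightarrow> int set) \<Rightarrow> nat \<Rightarrow> nat \<Rightarrow> (int \<Rightarrow> real) \<Rightarrow> int \<Rightarrow> real"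
  where
  "killed b D 0 n f x = f x"
| "killed b D (Suc j) n f x =
    (if x \<in> D n
     then (killed b D j (Suc n) f (x + b n) + killed b D j (Suc n) f (x - b n)) / 2 else 0)"

abbreviation free :: "(nat \<Rightarrow> int) \<Rightarrow> nat \<Rightarrow> nat \<Rightarrow> (int \<Rightarrow> real) \<Rightarrow> int \<Rightarrow> real" where
  "free b \<equiv> killed b (\<lambda>_. UNIV)"

lemma killed_add: "killed b D (i + j) n f x = killed b D i n (killed b D j (n + i) f) x"
  by (induction i arbitrary: n x) auto

lemma killed_plus: "killed b D j n (\<lambda>y. f y + g y) x = killed b D j n f x + killed b D j n g x"
  by (induction j arbitrary: n x) (auto simp: field_simps)

lemma killed_scale: "killed b D j n (\<lambda>y. c * f y) x = c * killed b D j n f x"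
  by (induction j arbitrary: n x) (auto simp: field_simps)

lemma killed_mono: "(\<And>y. f y \<le> g y) \<Longrightarrow> killed b D j n f x \<le> killed b D j n g x"
  by (induction j arbitrary: n x) (auto intro!: divide_right_mono add_mono)

lemma killed_nonneg: "(\<And>y. 0 \<le> f y) \<Longrightarrow> 0 \<le> killed b D j n f x"
  by (induction j arbitrary: n x) (auto intro!: divide_nonneg_pos add_nonneg_nonneg)

lemma killed_le_free:
  assumes "\<And>y. 0 \<le> f y"
  shows "killed b D j n f x \<le> free b j n f x"
proof (induction j arbitrary: n x)
  case (Suc j)
  then show ?case
    using assms by (auto intro!: divide_right_mono add_mono divide_nonneg_pos add_nonneg_nonneg killed_nonneg)
qed auto

lemma free_const [simp]: "free b j n (\<lambda>_. c) x = c"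
  by (induction j arbitrary: n x) auto

lemma killed_one_le_1: "killed b D j n (\<lambda>_. 1) x \<le> 1"
  using killed_le_free[of "\<lambda>_. 1" b D j n x] by simp

lemma free_square:
  "free b j n (\<lambda>y. (of_int y)\<^sup>2) x = (of_int x)\<^sup>2 + (\<Sum>i<j. (of_int (b (n + i)))\<^sup>2)"
proof (induction j arbitrary: n x)
  case (Suc j)
  have "(\<Sum>i<Suc j. (of_int (b (n + i)) :: real)\<^sup>2) = (of_int (b n))\<^sup>2 + (\<Sum>i<j. (of_int (b (Suc n + i)))\<^sup>2)"
    by (subst sum.lessThan_Suc_shift) simp
  moreover have "free b (Suc j) n (\<lambda>y. (of_int y)\<^sup>2) x
      = (of_int x)\<^sup>2 + (of_int (b n))\<^sup>2 + (\<Sum>i<j. (of_int (b (Suc n + i)))\<^sup>2)"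
    unfolding killed.simps Suc by (simp add: power2_eq_square algebra_simps)
  ultimately show ?case by linarith
qed simp

text \<open>
  The expected time spent outside \<open>D\<close> from time \<open>n\<close> until before \<open>n + j\<close>. The walk is not killed
  here, so it may be outside many times.
\<close>
definition visits :: "(nat \<Rightarrow> int) \<Rightarrow> (nat \<Rightarrow> int set) \<Rightarrow> nat \<Rightarrow> nat \<Rightarrow> int \<Rightarrow> real" where
  "visits b D j n x = (\<Sum>i<j. free b i n (indicator (- D (n + i))) x)"

lemma visits_Suc:
  "visits b D (Suc j) n x = indicator (- D n) x +
     (visits b D j (Suc n) (x + b n) + visits b D j (Suc n) (x - b n)) / 2"
  unfolding visits_def
  by (subst sum.lessThan_Suc_shift) (simp add: sum.distrib flip: sum_divide_distrib)

text \<open>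
  Decomposition at the first exit: there are no visits to the complement of \<open>D\<close> before it, and
  from it on at most \<open>G\<close> are expected. Hence the quotient of the expected number of
  visits and \<open>G\<close> is a lower bound for the probability of leaving \<open>D\<close>.
\<close>
lemma visits_le:
  assumes "\<And>i y. i < j \<Longrightarrow> y \<notin> D (n + i) \<Longrightarrow> visits b D (j - i) (n + i) y \<le> G"
  shows "visits b D j n x \<le> G * (1 - killed b D j n (\<lambda>_. 1) x)"
  using assms
proof (induction j arbitrary: n x)
  case 0
  then show ?case by (simp add: visits_def)
next
  case (Suc j)
  show ?case
  proof (cases "x \<in> D n")
    case False
    then show ?thesis using Suc.prems[of 0 x] by simp
  next
    case True
    have "visits b D j (Suc n) y \<le> G * (1 - killed b D j (Suc n) (\<lambda>_. 1) y)" for y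
      by (rule Suc.IH) (use Suc.prems[of "Suc _"] in auto)
    from this[of "x + b n"] this[of "x - b n"] show ?thesis
      using True by (simp add: visits_Suc field_simps)
  qed
qed

text \<open>
  If the steps alternate between \<open>s\<close> and \<open>t\<close>, then after \<open>m\<close> pairs of steps the displacement is
  \<open>s U + t V\<close>, where \<open>U\<close> and \<open>V\<close> are two independent simple random walks of length \<open>m\<close>.
\<close>
lemma free_two_steps:
  assumes "\<And>i. i < m \<Longrightarrow> b (n + 2 * i) = s \<and> b (n + 2 * i + 1) = t"
  shows "free b (2 * m) n f x = srw_avg m (\<lambda>v. srw_avg m (\<lambda>u. f (x + s * u + t * v)))"
  using assms
proof (induction m arbitrary: n x)
  case (Suc m)
  have b: "b n = s" "b (Suc n) = t" using Suc.prems[of 0] by auto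
  have IH: "free b (2 * m) (Suc (Suc n)) f y = srw_avg m (\<lambda>v. srw_avg m (\<lambda>u. f (y + s * u + t * v)))" for y
  proof (rule Suc.IH)
    fix i assume "i < m"
    then show "b (Suc (Suc n) + 2 * i) = s \<and> b (Suc (Suc n) + 2 * i + 1) = t"
      using Suc.prems[of "Suc i"] by simp
  qed
  have shift:
    "x + s * (u + 1) + t * (v + 1) = x + s + t + s * u + t * v"
    "x + s * (u - 1) + t * (v + 1) = x - s + t + s * u + t * v"
    "x + s * (u + 1) + t * (v - 1) = x + s - t + s * u + t * v"
    "x + s * (u - 1) + t * (v - 1) = x - s - t + s * u + t * v" for u v
    by (simp_all add: algebra_simps)
  show ?case
    by (simp add: b IH srw_avg_Suc srw_avg_add srw_avg_divide shift)
qed simp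

section \<open>The step sequence and one block of time\<close>

text \<open>
  Block \<open>k\<close> consists of the times \<open>n\<close> with \<open>4 ^ k \<le> n < 4 ^ Suc k\<close>; in it the step size
  alternates between \<open>2 ^ k\<close> at even and \<open>2 ^ k + 1\<close> at odd times.
\<close>
definition step_size :: "nat \<Rightarrow> nat" where
  "step_size n = 2 ^ (floor_log n div 2) + n mod 2"

lemma step_size_block:
  assumes "4 ^ k \<le> n" "n < 4 ^ Suc k"
  shows "step_size n = 2 ^ k + n mod 2"
proof -
  have "floor_log ((2::nat) ^ (2 * k)) \<le> floor_log n"
    using assms(1) by (intro floor_log_le_iff) (simp add: power_mult)
  moreover have "floor_log n < 2 * Suc k"
  proof (rule ccontr)
    assume "\<not> ?thesis"
    then have "(2::nat) ^ (2 * Suc k) \<le> 2 ^ floor_log n" by (intro power_increasing) auto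
    also have "\<dots> \<le> n" by (rule floor_log_exp2_le) (use assms(1) in \<open>cases n; auto\<close>)
    finally show False using assms(2) by (simp add: power_mult)
  qed
  ultimately have "floor_log n div 2 = k" by auto
  then show ?thesis by (simp add: step_size_def)
qed

lemma step_size_bounds:
  assumes "n \<ge> 1"
  shows "n < 4 * (step_size n)\<^sup>2" and "(step_size n)\<^sup>2 \<le> 4 * n"
proof -
  let ?l = "floor_log n" and ?p = "2 ^ (floor_log n div 2) :: nat"
  have p: "?p\<^sup>2 = 2 ^ (2 * (?l div 2))" by (simp add: power_mult[symmetric] mult.commute)
  have "n < 2 ^ Suc ?l" using floor_log_exp2_gt[of n] by simp
  also have "\<dots> \<le> 2 ^ (2 * (?l div 2) + 2)" by (intro power_increasing) auto
  also have "\<dots> = 4 * ?p\<^sup>2" by (simp add: p)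
  also have "\<dots> \<le> 4 * (step_size n)\<^sup>2" by (simp add: step_size_def power_mono)
  finally show "n < 4 * (step_size n)\<^sup>2" .
  have "step_size n \<le> ?p + 1" using step_size_def[of n] by simp
  also have "\<dots> \<le> 2 * ?p" by simp
  finally have "(step_size n)\<^sup>2 \<le> (2 * ?p)\<^sup>2" by (rule power_mono) simp
  also have "\<dots> = 4 * 2 ^ (2 * (?l div 2))" by (simp add: power_mult_distrib p)
  also have "(2::nat) ^ (2 * (?l div 2)) \<le> 2 ^ ?l" by (intro power_increasing) auto
  also have "(2::nat) ^ ?l \<le> n" by (rule floor_log_exp2_le) (use assms in simp)
  finally show "(step_size n)\<^sup>2 \<le> 4 * n" by simp
qed

text \<open>
  The walk is killed at \<open>0\<close>, from time \<open>N\<close> on, and only at even times: inside a block these are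
  the times after complete pairs of steps.
\<close>
definition alive :: "nat \<Rightarrow> nat \<Rightarrow> int set" where
  "alive N n = (if N \<le> n \<and> even n then - {0} else UNIV)"

text \<open>
  By \<open>free_two_steps\<close> this is the probability that a walk at \<open>x\<close> is at \<open>0\<close> after \<open>m\<close> pairs of
  steps in block \<open>k\<close>.
\<close>
definition hit_prob :: "nat \<Rightarrow> nat \<Rightarrow> int \<Rightarrow> real" where
  "hit_prob k m x = srw_avg m (\<lambda>v. srw_avg m (\<lambda>u. of_bool (x + 2 ^ k * u + (2 ^ k + 1) * v = 0)))"

lemma hit_prob_nonneg: "0 \<le> hit_prob k m x"
  unfolding hit_prob_def srw_avg_def by (intro sum_nonneg mult_nonneg_nonneg) (auto simp: srw_nonneg)

abbreviation walk_step :: "nat \<Rightarrow> int" where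
  "walk_step n \<equiv> int (step_size n)"

lemma visits_block:
  assumes "even n" "N \<le> n" "4 ^ k \<le> n" "n + 2 * m \<le> 4 ^ Suc k"
  shows "visits walk_step (alive N) (2 * m) n x = (\<Sum>i<m. hit_prob k i x)"
  using assms(4)
proof (induction m)
  case 0
  then show ?case by (simp add: visits_def)
next
  case (Suc m)
  have "free walk_step (2 * m) n (indicator {0}) x = hit_prob k m x"
  proof (subst free_two_steps)
    show "walk_step (n + 2 * i) = 2 ^ k \<and> walk_step (n + 2 * i + 1) = 2 ^ k + 1" if "i < m" for i
      using step_size_block[of k "n + 2 * i"] step_size_block[of k "n + 2 * i + 1"] that Suc.prems assms
      by auto
    show "srw_avg m (\<lambda>v. srw_avg m (\<lambda>u. indicator {0} (x + 2 ^ k * u + (2 ^ k + 1) * v))) = hit_prob k m x"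
      unfolding hit_prob_def by (simp add: indicator_def of_bool_def)
  qed
  moreover have "alive N (n + 2 * m) = - {0}" "alive N (n + (2 * m + 1)) = UNIV"
    using assms by (auto simp: alive_def)
  moreover have "visits walk_step (alive N) (2 * m) n x = (\<Sum>i<m. hit_prob k i x)"
    using Suc by simp
  moreover have "indicator {} = (\<lambda>_::int. 0::real)" by auto
  ultimately show ?case by (simp add: visits_def)
qed

lemma srw_avg_ge_term:
  assumes "\<And>w. 0 \<le> g w"
  shows "srw m v * g v \<le> srw_avg m g"
proof (cases "v \<in> {-int m..int m}")
  case True
  then show ?thesis unfolding srw_avg_def
    by (rule member_le_sum) (auto simp: srw_nonneg assms)
next
  case False
  then have "srw m v = 0" by (intro srw_eq_0) auto
  then show ?thesis unfolding srw_avg_def by (simp add: sum_nonneg srw_nonneg assms)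
qed

text \<open>
  It suffices to find one pair \<open>(u, v)\<close> of positions of the two simple random walks, both of
  order \<open>sqrt m\<close> and of the parity of \<open>m\<close>, which moves the walk from \<open>x\<close> to \<open>0\<close>. Write \<open>s = 2 ^ k\<close>.
  The residue of \<open>x\<close> modulo \<open>2 s\<close> has to be cancelled by \<open>v\<close> alone, as \<open>u + v\<close> is even and \<open>s (u + v)\<close> a
  multiple of \<open>2 s\<close>; then \<open>u\<close> corrects the remaining multiple of \<open>2 s\<close>. Since \<open>s\<close> is even, the only parity
  constraint is that \<open>m + x\<close> is even.
\<close>
lemma hit_prob_ge:
  fixes K :: nat
  assumes k: "8 * (K + 4) \<le> 2 ^ k" and x: "\<bar>x\<bar> \<le> int K * 4 ^ k"
    and m: "4 ^ k \<le> 2 * m" "even (int m + x)"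
  shows "hit_prob k m x \<ge> exp (- 8 * (real K + 4)\<^sup>2) / (4 * real m)"
proof -
  define s where "s = (2::int) ^ k"
  define d where "d = (- x) div (2 * s)"
  define v where "v = (- x) mod (2 * s)"
  define u where "u = 2 * d - v"
  define L where "L = 2 * (real K + 4)\<^sup>2"
  have s: "s \<ge> 1" "s * s = 4 ^ k" unfolding s_def by (auto simp: power_mult_distrib[symmetric])
  have k1: "k \<ge> 1" using k by (cases k) auto
  have es: "even s" using k1 by (simp add: s_def)
  have xv: "x = - (2 * s * d) - v"
    using mult_div_mod_eq[of "2 * s" "- x"] unfolding d_def v_def by linarith
  have v: "0 \<le> v" "v < 2 * s" using s unfolding v_def by auto
  have pv: "even (int m + v)" using m(2) xv by simp
  have pu: "even (int m + u)" using pv unfolding u_def by simp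
  have zero: "x + s * u + (s + 1) * v = 0" unfolding u_def using xv by (simp add: algebra_simps)
  have "s * (2 * \<bar>d\<bar>) = \<bar>x + v\<bar>" using s xv by (simp add: abs_mult)
  also have "\<dots> \<le> int K * (s * s) + 2 * s" using x v s by (simp add: abs_le_iff)
  also have "\<dots> = s * (int K * s + 2)" by (simp add: algebra_simps)
  finally have d: "2 * \<bar>d\<bar> \<le> int K * s + 2"
    using mult_le_cancel_left_pos[of s] s(1) by simp
  have Ks: "(int K + 4) * s = int K * s + 4 * s" by (rule distrib_right)
  have "0 \<le> int K * s" using s(1) by simp
  then have v': "\<bar>v\<bar> \<le> (int K + 4) * s" unfolding Ks using v by linarith
  have "\<bar>u\<bar> \<le> 2 * \<bar>d\<bar> + v" unfolding u_def using v(1) by linarith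
  then have u: "\<bar>u\<bar> \<le> (int K + 4) * s" unfolding Ks using d v(2) s(1) by linarith
  have toA: "\<bar>real_of_int w\<bar> \<le> (real K + 4) * of_int s" if "\<bar>w\<bar> \<le> (int K + 4) * s" for w
  proof -
    have "real_of_int \<bar>w\<bar> \<le> real_of_int ((int K + 4) * s)"
      using that by (simp only: of_int_le_iff)
    then show ?thesis by simp
  qed
  let ?A = "(real K + 4) * of_int s"
  have s2: "real_of_int s * of_int s \<le> 2 * real m"
  proof -
    have "real (4 ^ k) \<le> real (2 * m)" using m(1) by (simp only: of_nat_le_iff)
    moreover have "real_of_int (s * s) = 4 ^ k" unfolding s(2) by simp
    ultimately show ?thesis by simp
  qed
  have m1: "m \<ge> 1" using m(1) by (cases m) auto
  have A4: "4 * ?A \<le> real m"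
  proof -
    have "real (8 * (K + 4)) \<le> real (2 ^ k)" using k by (simp only: of_nat_le_iff)
    then have "8 * (real K + 4) \<le> of_int s" by (simp add: s_def)
    then have "8 * (real K + 4) * of_int s \<le> of_int s * of_int s"
      using s by (intro mult_right_mono) auto
    from order_trans[OF this s2] show ?thesis by (simp add: algebra_simps)
  qed
  have A2: "?A\<^sup>2 \<le> L * real m"
  proof -
    have "?A\<^sup>2 = (real K + 4)\<^sup>2 * (of_int s * of_int s)" by (simp add: power2_eq_square)
    also have "\<dots> \<le> (real K + 4)\<^sup>2 * (2 * real m)" by (intro mult_left_mono s2) auto
    finally show ?thesis by (simp add: L_def)
  qed
  let ?c = "exp (- 2 * L) / (2 * sqrt (real m))"
  have "srw m u \<ge> ?c" "srw m v \<ge> ?c"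
    using srw_gaussian_lower[OF m1 pu toA[OF u] A4 A2] srw_gaussian_lower[OF m1 pv toA[OF v'] A4 A2] by auto
  then have "?c * ?c \<le> srw m v * srw m u" by (intro mult_mono) (auto simp: srw_nonneg)
  also have "srw m u \<le> srw_avg m (\<lambda>u. of_bool (x + s * u + (s + 1) * v = 0))"
    using srw_avg_ge_term[of "\<lambda>u. of_bool (x + s * u + (s + 1) * v = 0)" m u] zero by simp
  also have "srw m v * \<dots> \<le> srw_avg m (\<lambda>v. srw_avg m (\<lambda>u. of_bool (x + s * u + (s + 1) * v = 0)))"
    by (rule srw_avg_ge_term) (auto simp: srw_avg_def intro!: sum_nonneg mult_nonneg_nonneg srw_nonneg)
  also have "\<dots> = hit_prob k m x" by (simp add: hit_prob_def s_def)
  finally have "?c * ?c \<le> hit_prob k m x" by (simp add: srw_nonneg mult_left_mono)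
  moreover have "?c * ?c = exp (- 8 * (real K + 4)\<^sup>2) / (4 * real m)"
  proof -
    have "?c * ?c = (exp (- 2 * L) * exp (- 2 * L)) / (4 * (sqrt (real m) * sqrt (real m)))" by simp
    also have "exp (- 2 * L) * exp (- 2 * L) = exp (- 8 * (real K + 4)\<^sup>2)"
      by (simp add: exp_add[symmetric] L_def)
    finally show ?thesis by simp
  qed
  ultimately show ?thesis by (simp only:)
qed

lemma sum_inverse_squares_le:
  "m \<ge> 1 \<Longrightarrow> (\<Sum>l\<in>{-int m..int m}. 1 / (of_int l)\<^sup>2) \<le> (4 - 2 / real m :: real)"
proof (induction m rule: dec_induct)
  case base
  have "{-1..1::int} = {-1, 0, 1}" by auto
  then show ?case by simp
next
  case (step m)
  have "{-int (Suc m)..int (Suc m)} = insert (- int m - 1) (insert (int m + 1) {-int m..int m})" by auto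
  then have "(\<Sum>l\<in>{-int (Suc m)..int (Suc m)}. 1 / (of_int l)\<^sup>2)
    = 2 / (real m + 1)\<^sup>2 + (\<Sum>l\<in>{-int m..int m}. 1 / (of_int l)\<^sup>2 :: real)"
    by (simp add: power2_eq_square algebra_simps)
  also have "\<dots> \<le> 2 / (real m + 1)\<^sup>2 + (4 - 2 / real m)" using step by simp
  also have "\<dots> \<le> 4 - 2 / real (Suc m)"
  proof -
    have "1 / (real m + 1)\<^sup>2 \<le> 1 / (real m * (real m + 1))"
      using step by (intro divide_left_mono) (auto simp: power2_eq_square)
    also have "\<dots> = 1 / real m - 1 / (real m + 1)" using step by (simp add: field_simps)
    finally show ?thesis by (simp add: add.commute)
  qed
  finally show ?case .
qed

text \<open>
  Write \<open>s = 2 ^ k\<close>. As \<open>s\<close> and \<open>s + 1\<close> are coprime, \<open>s u + (s + 1) v = 0\<close> forces \<open>v = s l\<close> and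
  \<open>u = - (s + 1) l\<close>. The term \<open>l = 0\<close> is a return of a planar walk and contributes at most \<open>1 / m\<close>; each of the
  two factors of a term with \<open>l \<noteq> 0\<close> is at most \<open>2 / (s \<bar>l\<bar>)\<close>, so that these terms together
  contribute \<open>O(1 / s\<^sup>2)\<close>.
\<close>
lemma return_prob_le:
  assumes "m \<ge> 1"
  shows "hit_prob k m 0 \<le> 1 / real m + 16 / 4 ^ k"
proof -
  define s where "s = (2::int) ^ k"
  define \<phi> where "\<phi> v = srw_avg m (\<lambda>u. of_bool (s * u + (s + 1) * v = 0))" for v
  have s: "s \<ge> 1" "s * s = 4 ^ k" unfolding s_def by (auto simp: power_mult_distrib[symmetric])
  have \<phi>0: "\<phi> v = 0" if "\<not> s dvd v" for v
  proof -
    have "s * u + (s + 1) * v \<noteq> 0" for u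
    proof
      assume "s * u + (s + 1) * v = 0"
      then have "v = s * (- u - v)" by (simp add: algebra_simps)
      then show False using that by (metis dvd_triv_left)
    qed
    then show ?thesis by (simp add: \<phi>_def)
  qed
  have \<phi>s: "\<phi> (s * l) = srw m ((s + 1) * l)" for l
  proof -
    have "(s * u + (s + 1) * (s * l) = 0) \<longleftrightarrow> u = - ((s + 1) * l)" for u
    proof -
      have "s * u + (s + 1) * (s * l) = s * (u + (s + 1) * l)" by (simp add: algebra_simps)
      then show ?thesis using s by auto
    qed
    then show ?thesis unfolding \<phi>_def by (simp add: srw_avg_point srw_uminus)
  qed
  have \<phi>nn: "0 \<le> \<phi> v" for v
    unfolding \<phi>_def srw_avg_def by (intro sum_nonneg mult_nonneg_nonneg) (auto simp: srw_nonneg)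
  let ?I = "{-int m..int m}"
  have "hit_prob k m 0 = (\<Sum>v\<in>?I. srw m v * \<phi> v)"
    by (simp add: hit_prob_def \<phi>_def s_def srw_avg_def)
  also have "\<dots> = (\<Sum>v\<in>{v\<in>?I. s dvd v}. srw m v * \<phi> v)"
    by (intro sum.mono_neutral_right) (auto simp: \<phi>0)
  also have "\<dots> \<le> (\<Sum>v\<in>(\<lambda>l. s * l) ` ?I. srw m v * \<phi> v)"
  proof (intro sum_mono2)
    show "{v\<in>?I. s dvd v} \<subseteq> (\<lambda>l. s * l) ` ?I"
    proof
      fix v assume v: "v \<in> {v\<in>?I. s dvd v}"
      then obtain l where l: "v = s * l" by auto
      have "\<bar>l\<bar> \<le> \<bar>v\<bar>" unfolding l abs_mult using s by (simp add: mult_le_cancel_right1)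
      then have "l \<in> ?I" using v by auto
      then show "v \<in> (\<lambda>l. s * l) ` ?I" unfolding l by (rule imageI)
    qed
  qed (auto simp: srw_nonneg \<phi>nn)
  also have "\<dots> = (\<Sum>l\<in>?I. srw m (s * l) * srw m ((s + 1) * l))"
    using s by (subst sum.reindex) (auto simp: inj_on_def \<phi>s)
  also have "\<dots> \<le> (\<Sum>l\<in>?I. (if l = 0 then 1 / real m else 0) + 4 / 4 ^ k * (1 / (of_int l)\<^sup>2))"
  proof (intro sum_mono)
    fix l
    show "srw m (s * l) * srw m ((s + 1) * l)
       \<le> (if l = 0 then 1 / real m else 0) + 4 / 4 ^ k * (1 / (of_int l)\<^sup>2)"
    proof (cases "l = 0")
      case True
      have "srw m 0 * srw m 0 \<le> 1 / sqrt (real m) * (1 / sqrt (real m))"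
        using assms by (intro mult_mono srw_le_inverse_sqrt) (auto simp: srw_nonneg)
      then show ?thesis using True by simp
    next
      case False
      have a: "srw m (s * l) \<le> 2 / (of_int s * \<bar>of_int l\<bar>)"
        using srw_le_inverse_abs[of "s * l" m] s False by (simp add: abs_mult)
      have "srw m ((s + 1) * l) \<le> 2 / ((of_int s + 1) * \<bar>of_int l\<bar>)"
        using srw_le_inverse_abs[of "(s + 1) * l" m] s False by (simp add: abs_mult)
      also have "\<dots> \<le> 2 / (of_int s * \<bar>of_int l\<bar>)"
        using s False by (intro divide_left_mono mult_right_mono mult_pos_pos) auto
      finally have "srw m (s * l) * srw m ((s + 1) * l)
          \<le> 2 / (of_int s * \<bar>of_int l\<bar>) * (2 / (of_int s * \<bar>of_int l\<bar>))"
        using a s by (intro mult_mono) (auto simp: srw_nonneg)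
      also have "\<dots> = 4 / of_int (s * s) * (1 / (of_int l)\<^sup>2)"
        by (simp add: power2_eq_square)
      also have "\<dots> = 4 / 4 ^ k * (1 / (of_int l)\<^sup>2)" unfolding s(2) by simp
      finally show ?thesis using False by simp
    qed
  qed
  also have "\<dots> = 1 / real m + 4 / 4 ^ k * (\<Sum>l\<in>?I. 1 / (of_int l)\<^sup>2)"
    by (simp add: sum.distrib sum_distrib_left)
  also have "\<dots> \<le> 1 / real m + 4 / 4 ^ k * 4"
    using order_trans[OF sum_inverse_squares_le[OF assms], of 4] by (intro add_left_mono mult_left_mono) auto
  finally show ?thesis by simp
qed

lemma harm_le_ln: "n \<ge> 1 \<Longrightarrow> harm n \<le> (ln (real n) + 1 :: real)"
  using euler_mascheroni_sequence_decreasing[of 1 n] by (simp add: harm_expand)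

text \<open>
  The planar returns sum to a harmonic sum, that is, to order \<open>k\<close>; the others, at most
  \<open>16 / 4 ^ k\<close> each, sum to \<open>O(1)\<close> over the \<open>O(4 ^ k)\<close> pairs of steps of the block.
\<close>
lemma expected_returns_le:
  assumes "2 * m \<le> 3 * 4 ^ k"
  shows "(\<Sum>i<m. hit_prob k i 0) \<le> 30 * (real k + 1)"
proof (cases "m = 0")
  case False
  have "real (2 * m) \<le> real (3 * 4 ^ k)" using assms by (simp only: of_nat_le_iff)
  then have m: "2 * real m \<le> 3 * 4 ^ k" by simp
  obtain M where M: "m = Suc M" using False by (cases m) auto
  have "(\<Sum>i<m. hit_prob k i 0) = hit_prob k 0 0 + (\<Sum>i<M. hit_prob k (Suc i) 0)"
    unfolding M by (rule sum.lessThan_Suc_shift)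
  also have "\<dots> \<le> 1 + (\<Sum>i<M. inverse (real (Suc i)) + 16 / 4 ^ k)"
  proof (intro add_mono sum_mono)
    show "hit_prob k 0 0 \<le> 1" by (simp add: hit_prob_def)
    show "hit_prob k (Suc i) 0 \<le> inverse (real (Suc i)) + 16 / 4 ^ k" for i
      using return_prob_le[of "Suc i" k] by (simp add: inverse_eq_divide)
  qed
  also have "\<dots> = 1 + harm M + real M * (16 / 4 ^ k)"
    by (simp add: harm_altdef sum.distrib)
  also have "\<dots> \<le> 1 + harm m + (3 / 2 * 4 ^ k) * (16 / 4 ^ k)"
    using m M by (intro add_mono mult_right_mono harm_mono) auto
  also have "\<dots> = 25 + harm m" by simp
  also have "harm m \<le> ln (real m) + 1" using M by (intro harm_le_ln) simp
  also have "ln (real m) \<le> ln (4 ^ Suc k)" using m M by (subst ln_le_cancel_iff) auto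
  also have "\<dots> = (real k + 1) * (2 * ln 2)"
    using ln_realpow[of "2::real" 2] by (subst ln_realpow) (auto simp: algebra_simps)
  also have "\<dots> \<le> (real k + 1) * (2 * 1)"
    using ln_2_less_1 by (intro mult_left_mono) auto
  finally show ?thesis by simp
qed simp

text \<open>
  In the last two thirds of the block every second number of pairs has the right parity and
  contributes at least a constant times \<open>1 / 4 ^ k\<close>.
\<close>
lemma expected_hits_ge:
  fixes K :: nat
  assumes k: "8 * (K + 4) \<le> 2 ^ k" and x: "\<bar>x\<bar> \<le> int K * 4 ^ k" and m: "2 * m = 3 * 4 ^ k"
  shows "(\<Sum>i<m. hit_prob k i x) \<ge> exp (- 8 * (real K + 4)\<^sup>2) / 12"
proof -
  obtain k' where k': "k = Suc k'" using k by (cases k) auto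
  (* The block has 3 H pairs of steps; the times t i are in its last two thirds. *)
  define H where "H = (2::nat) * 4 ^ k'"
  have H: "4 ^ k = 2 * H" "m = 3 * H" "H > 0" using m by (auto simp: H_def k')
  define p where "p = nat ((int H + x) mod 2)"
  define t where "t i = H + 2 * i + p" for i
  have p: "p \<le> 1" "int p = (int H + x) mod 2" unfolding p_def by auto
  let ?c = "exp (- 8 * (real K + 4)\<^sup>2)"
  have "?c / 12 = (\<Sum>i<H. ?c / (4 * real m))" using H by simp
  also have "\<dots> \<le> (\<Sum>i<H. hit_prob k (t i) x)"
  proof (intro sum_mono)
    fix i assume "i \<in> {..<H}"
    then have t: "t i \<le> m" "t i > 0" "4 ^ k \<le> 2 * t i" using p H by (auto simp: t_def)
    have "even (int (t i) + x)" unfolding t_def using p(2) by simp presburger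
    then have "?c / (4 * real (t i)) \<le> hit_prob k (t i) x" using t by (intro hit_prob_ge k x) auto
    moreover have "?c / (4 * real m) \<le> ?c / (4 * real (t i))"
      using t by (intro divide_left_mono) auto
    ultimately show "?c / (4 * real m) \<le> hit_prob k (t i) x" by linarith
  qed
  also have "\<dots> = (\<Sum>i\<in>t ` {..<H}. hit_prob k i x)"
    by (subst sum.reindex) (auto simp: inj_on_def t_def)
  also have "\<dots> \<le> (\<Sum>i<m. hit_prob k i x)"
    using p H by (intro sum_mono2) (auto simp: t_def hit_prob_nonneg)
  finally show ?thesis .
qed

text \<open>
  An expected number of visits to \<open>0\<close> that is bounded below, and at most \<open>O(k)\<close> expected further
  ones after the first, leave a probability of order \<open>1 / k\<close> for hitting \<open>0\<close> in block \<open>k\<close>, uniformly over starting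
  points in the range that the walk typically occupies.
\<close>
lemma block_survival:
  fixes K :: nat
  assumes k: "8 * (K + 4) \<le> 2 ^ k" and x: "\<bar>x\<bar> \<le> int K * 4 ^ k" and N: "N \<le> 4 ^ k"
  shows "killed walk_step (alive N) (3 * 4 ^ k) (4 ^ k) (\<lambda>_. 1) x
    \<le> 1 - exp (- 8 * (real K + 4)\<^sup>2) / 360 / (real k + 1)"
proof -
  obtain k' where k': "k = Suc k'" using k by (cases k) auto
  define m :: nat where "m = 6 * 4 ^ k'"
  have m: "2 * m = 3 * 4 ^ k" by (simp add: m_def k')
  let ?b = walk_step and ?D = "alive N" and ?G = "30 * (real k + 1)"
  have e: "even ((4::nat) ^ k)" by (simp add: k')
  have "exp (- 8 * (real K + 4)\<^sup>2) / 12 \<le> (\<Sum>i<m. hit_prob k i x)" by (rule expected_hits_ge[OF k x m])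
  also have "\<dots> = visits ?b ?D (2 * m) (4 ^ k) x"
    by (rule visits_block[symmetric]) (use e N m in auto)
  also have "\<dots> \<le> ?G * (1 - killed ?b ?D (2 * m) (4 ^ k) (\<lambda>_. 1) x)"
  proof (rule visits_le)
    fix i y assume i: "i < 2 * m" and y: "y \<notin> ?D (4 ^ k + i)"
    have y0: "y = 0" and ei: "even i" using y e by (auto simp: alive_def split: if_splits)
    obtain l where l: "i = 2 * l" using ei by blast
    have "visits ?b ?D (2 * (m - l)) (4 ^ k + i) 0 = (\<Sum>j<m - l. hit_prob k j 0)"
      by (rule visits_block) (use e N m i l in auto)
    also have "\<dots> \<le> ?G" by (rule expected_returns_le) (use m in auto)
    finally show "visits ?b ?D (2 * m - i) (4 ^ k + i) y \<le> ?G"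
      by (simp add: y0 l diff_mult_distrib2)
  qed
  finally show ?thesis unfolding m by (simp add: field_simps)
qed

definition survival :: "nat \<Rightarrow> nat \<Rightarrow> real" where
  "survival N j = killed walk_step (alive N) j 0 (\<lambda>_. 1) 0"

lemma free_square_le: "free walk_step n 0 (\<lambda>y. (of_int y)\<^sup>2) 0 \<le> 4 * (real n)\<^sup>2"
proof -
  have "(real (step_size i))\<^sup>2 \<le> 4 * real n" if "i < n" for i
  proof (cases "i = 0")
    case True
    then show ?thesis using that by (simp add: step_size_def)
  next
    case False
    then have "(step_size i)\<^sup>2 \<le> 4 * i" by (intro step_size_bounds) simp
    then have "(step_size i)\<^sup>2 \<le> 4 * n" using that by linarith
    then have "real ((step_size i)\<^sup>2) \<le> real (4 * n)" by (simp only: of_nat_le_iff)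
    then show ?thesis by simp
  qed
  then have "(\<Sum>i<n. (real (step_size i))\<^sup>2) \<le> (\<Sum>i<n. 4 * real n)"
    by (intro sum_mono) auto
  then show ?thesis unfolding free_square by (simp add: power2_eq_square)
qed

text \<open>
  One block multiplies the survival probability by at most \<open>1 - \<delta> / (k + 1)\<close>, up to an error from walks
  outside the range \<open>K * 4 ^ k\<close> at the start of the block. By Chebyshev their probability is at most
  \<open>4 / K\<^sup>2\<close>. The error carries the same factor \<open>\<delta> / (k + 1)\<close> as the gain, so that the bound is a
  decrease as long as the survival probability exceeds \<open>4 / K\<^sup>2\<close>.
\<close>
lemma survival_Suc_le:
  fixes K :: nat
  assumes "K \<ge> 1" and k: "8 * (K + 4) \<le> 2 ^ k" and N: "N \<le> 4 ^ k"
  defines "\<delta> \<equiv> exp (- 8 * (real K + 4)\<^sup>2) / 360"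
  shows "survival N (4 ^ Suc k) \<le> survival N (4 ^ k) - \<delta> / (real k + 1) * (survival N (4 ^ k) - 4 / (real K)\<^sup>2)"
proof -
  let ?b = walk_step and ?D = "alive N" and ?d = "\<delta> / (real k + 1)"
  let ?B = "real K * 4 ^ k"
  have d: "?d \<ge> 0" by (simp add: \<delta>_def)
  have B: "?B > 0" using assms(1) by simp
  (* Outside the range, the quadratic term alone exceeds the saving of the block. *)
  have pt: "killed ?b ?D (3 * 4 ^ k) (4 ^ k) (\<lambda>_. 1) y \<le> (1 - ?d) * 1 + ?d / ?B\<^sup>2 * (of_int y)\<^sup>2" for y
  proof (cases "\<bar>y\<bar> \<le> int K * 4 ^ k")
    case True
    have le: "killed ?b ?D (3 * 4 ^ k) (4 ^ k) (\<lambda>_. 1) y \<le> 1 - ?d"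
      using block_survival[OF k True N] by (simp add: \<delta>_def)
    have "0 \<le> ?d / ?B\<^sup>2 * (of_int y)\<^sup>2"
      by (intro mult_nonneg_nonneg divide_nonneg_nonneg) (auto simp: \<delta>_def)
    then show ?thesis unfolding mult_1_right using le by (rule add_increasing2)
  next
    case False
    then have "of_int (int K * 4 ^ k) \<le> (of_int \<bar>y\<bar> :: real)" by (simp only: of_int_le_iff)
    then have "?B \<le> \<bar>of_int y\<bar>" by simp
    then have "?B\<^sup>2 \<le> (of_int y)\<^sup>2" using B by (metis abs_le_square_iff abs_of_pos)
    then have "1 \<le> (of_int y)\<^sup>2 / ?B\<^sup>2"
      using zero_less_power[OF B, of 2] by (simp only: pos_le_divide_eq mult_1_left)
    then have "?d * 1 \<le> ?d * ((of_int y)\<^sup>2 / ?B\<^sup>2)" using d by (rule mult_left_mono)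
    then show ?thesis using killed_one_le_1[of ?b ?D "3 * 4 ^ k" "4 ^ k" y] by simp
  qed
  have "survival N (4 ^ Suc k) = killed ?b ?D (4 ^ k) 0 (killed ?b ?D (3 * 4 ^ k) (0 + 4 ^ k) (\<lambda>_. 1)) 0"
    unfolding survival_def by (subst killed_add[symmetric]) simp
  also have "\<dots> \<le> killed ?b ?D (4 ^ k) 0 (\<lambda>y. (1 - ?d) * 1 + ?d / ?B\<^sup>2 * (of_int y)\<^sup>2) 0"
    using pt by (intro killed_mono) simp
  also have "\<dots> = (1 - ?d) * survival N (4 ^ k) + ?d / ?B\<^sup>2 * killed ?b ?D (4 ^ k) 0 (\<lambda>y. (of_int y)\<^sup>2) 0"
    unfolding survival_def killed_plus killed_scale ..
  also have "\<dots> \<le> (1 - ?d) * survival N (4 ^ k) + ?d / ?B\<^sup>2 * (4 * (real (4 ^ k))\<^sup>2)"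
    by (intro add_left_mono mult_left_mono order_trans[OF killed_le_free free_square_le]) (auto simp: \<delta>_def)
  also have "?d / ?B\<^sup>2 * (4 * (real (4 ^ k))\<^sup>2) = ?d * (4 / (real K)\<^sup>2)"
    using assms(1) by (simp add: power_mult_distrib)
  finally show ?thesis by (simp add: algebra_simps)
qed

text \<open>
  As long as the survival probability exceeds \<open>e\<close>, with \<open>4 / K\<^sup>2 \<le> e / 2\<close>, it drops in block
  \<open>k\<close> by a constant times \<open>1 / (k + 1)\<close>. The harmonic series diverges, so this cannot last.
\<close>
lemma survival_small:
  assumes "e > 0"
  shows "\<exists>k. survival N (4 ^ k) \<le> e"
proof (rule ccontr)
  assume "\<not> ?thesis"
  then have big: "survival N (4 ^ k) > e" for k by (simp add: not_le)
  obtain K0 :: nat where K0: "8 / e < real K0" using reals_Archimedean2 by blast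
  define K where "K = Suc K0"
  have K: "K \<ge> 1" "4 / (real K)\<^sup>2 \<le> e / 2"
  proof -
    have "8 / e \<le> real K * 1" using K0 by (simp add: K_def)
    also have "\<dots> \<le> (real K)\<^sup>2" unfolding power2_eq_square by (intro mult_left_mono) (auto simp: K_def)
    finally show "4 / (real K)\<^sup>2 \<le> e / 2" using assms by (simp add: K_def field_simps)
  qed (simp add: K_def)
  define c where "c = exp (- 8 * (real K + 4)\<^sup>2) / 360 * (e / 2)"
  have c: "c > 0" using assms by (simp add: c_def)
  define k1 where "k1 = max N (8 * (K + 4))"
  have decr: "survival N (4 ^ Suc k) \<le> survival N (4 ^ k) - c * inverse (real (Suc k))" if "k \<ge> k1" for k
  proof -
    have "k < 2 ^ k" "(2::nat) ^ k \<le> 4 ^ k" by (auto intro: less_exp power_mono)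
    moreover have "8 * (K + 4) \<le> k" "N \<le> k" using that by (auto simp: k1_def)
    ultimately have "8 * (K + 4) \<le> 2 ^ k" "N \<le> 4 ^ k" by linarith+
    note step = survival_Suc_le[OF K(1) this]
    define d where "d = exp (- 8 * (real K + 4)\<^sup>2) / 360 / (real k + 1)"
    have "e / 2 \<le> survival N (4 ^ k) - 4 / (real K)\<^sup>2" using K(2) big[of k] by linarith
    then have "d * (e / 2) \<le> d * (survival N (4 ^ k) - 4 / (real K)\<^sup>2)"
      by (rule mult_left_mono) (simp add: d_def)
    then have "survival N (4 ^ Suc k) \<le> survival N (4 ^ k) - d * (e / 2)"
      by (rule order_trans[OF step[folded d_def] diff_left_mono])
    also have "d * (e / 2) = c * inverse (real (Suc k))"
    proof -
      have "real (Suc k) = real k + 1" by simp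
      then show ?thesis unfolding c_def d_def by (simp only: divide_inverse mult_ac)
    qed
    finally show ?thesis .
  qed
  have total: "survival N (4 ^ (k1 + j)) \<le> 1 - c * (harm (k1 + j) - harm k1)" for j
  proof (induction j)
    case 0
    show ?case by (simp add: survival_def killed_one_le_1)
  next
    case (Suc j)
    then show ?case using decr[of "k1 + j"] by (simp add: harm_Suc algebra_simps)
  qed
  have "eventually (\<lambda>n. 1 / c + harm k1 < (harm n :: real)) sequentially"
    using harm_at_top by (simp add: filterlim_at_top_dense)
  then have "eventually (\<lambda>n. 1 / c + harm k1 < (harm n :: real) \<and> n \<ge> k1) sequentially"
    using eventually_ge_at_top[of k1] by eventually_elim simp
  then obtain n where "n \<ge> k1" "1 / c + harm k1 < (harm n :: real)"
    by (auto simp: eventually_at_top_linorder)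
  then obtain j where "1 / c < harm (k1 + j) - (harm k1 :: real)"
    by (metis le_iff_add less_diff_eq)
  then have "1 < c * (harm (k1 + j) - harm k1)" using c by (simp add: field_simps)
  then show False using total[of j] big[of "k1 + j"] assms by simp
qed

section \<open>Transfer to Rademacher sequences\<close>

context rademacher_sequence
begin

definition cylinder :: "nat \<Rightarrow> (nat \<Rightarrow> int) \<Rightarrow> 'w set" where
  "cylinder n \<sigma> = {\<omega> \<in> space M. \<forall>i\<in>{1..n}. \<epsilon> i \<omega> = of_int (\<sigma> i)}"

lemma measurable_sign: "k \<ge> 1 \<Longrightarrow> \<epsilon> k \<in> borel_measurable M"
  using indep unfolding indep_vars_def2 by auto

lemma measurable_walk [measurable]: "rademacher_walk \<epsilon> a n \<in> borel_measurable M"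
  unfolding rademacher_walk_def by (intro borel_measurable_sum borel_measurable_times measurable_sign) auto

lemma AE_sign: "AE \<omega> in M. \<forall>k\<ge>1. \<epsilon> k \<omega> = 1 \<or> \<epsilon> k \<omega> = -1"
proof -
  have "AE \<omega> in M. k \<ge> 1 \<longrightarrow> \<epsilon> k \<omega> = 1 \<or> \<epsilon> k \<omega> = -1" for k
  proof (cases "k \<ge> 1")
    case True
    then have [measurable]: "\<epsilon> k \<in> borel_measurable M" by (rule measurable_sign)
    have "prob {\<omega> \<in> space M. \<epsilon> k \<omega> = 1 \<or> \<epsilon> k \<omega> = -1}
        = prob ({\<omega> \<in> space M. \<epsilon> k \<omega> = 1} \<union> {\<omega> \<in> space M. \<epsilon> k \<omega> = -1})"
      by (intro arg_cong[where f = prob]) auto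
    also have "\<dots> = 1"
      by (subst finite_measure_Union) (auto simp: prob_pos[OF True] prob_neg[OF True])
    finally show ?thesis
      by (subst (asm) prob_Collect_eq_1) auto
  qed auto
  then show ?thesis by (simp add: AE_all_countable)
qed

lemma prob_cylinder:
  assumes "\<And>i. i \<ge> 1 \<Longrightarrow> \<sigma> i = 1 \<or> \<sigma> i = -1"
  shows "prob (cylinder n \<sigma>) = (1 / 2) ^ n"
proof (cases "n = 0")
  case True
  then show ?thesis by (simp add: cylinder_def prob_space)
next
  case False
  have "indep_vars (\<lambda>_. borel) \<epsilon> {1..n}" by (rule indep_vars_subset[OF indep]) auto
  then have "prob (\<Inter>i\<in>{1..n}. \<epsilon> i -` {of_int (\<sigma> i)} \<inter> space M)
      = (\<Prod>i\<in>{1..n}. prob (\<epsilon> i -` {of_int (\<sigma> i)} \<inter> space M))"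
    by (rule indep_varsD_finite) (use False in auto)
  also have "\<dots> = (\<Prod>i\<in>{1..n}. 1 / 2)"
  proof (intro prod.cong refl)
    fix i assume i: "i \<in> {1..n}"
    have "\<epsilon> i -` {of_int (\<sigma> i)} \<inter> space M = {\<omega> \<in> space M. \<epsilon> i \<omega> = of_int (\<sigma> i)}" by auto
    then show "prob (\<epsilon> i -` {of_int (\<sigma> i)} \<inter> space M) = 1 / 2"
      using assms[of i] prob_pos[of i] prob_neg[of i] i by auto
  qed
  also have "(\<Inter>i\<in>{1..n}. \<epsilon> i -` {of_int (\<sigma> i)} \<inter> space M) = cylinder n \<sigma>"
    using False by (auto simp: cylinder_def)
  finally show ?thesis by simp
qed

definition stays :: "(nat \<Rightarrow> real) \<Rightarrow> (nat \<Rightarrow> int set) \<Rightarrow> nat \<Rightarrow> nat \<Rightarrow> 'w set" where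
  "stays a D n j = {\<omega> \<in> space M. \<forall>m\<in>{n..<n + j}. rademacher_walk \<epsilon> a m \<omega> \<in> of_int ` D m}"

lemma sets_cylinder [measurable]: "cylinder n \<sigma> \<in> events"
  unfolding cylinder_def
proof (rule sets.sets_Collect_finite_All)
  fix i assume "i \<in> {1..n}"
  then have [measurable]: "\<epsilon> i \<in> borel_measurable M" by (intro measurable_sign) simp
  show "{\<omega> \<in> space M. \<epsilon> i \<omega> = of_int (\<sigma> i)} \<in> events" by measurable
qed simp

lemma sets_stays [measurable]: "stays a D n j \<in> events"
proof -
  have "{\<omega> \<in> space M. rademacher_walk \<epsilon> a m \<omega> \<in> of_int ` D m} \<in> events" for m
  proof -
    have "countable (of_int ` D m :: real set)" by (intro countable_image countableI_type)
    then have "(of_int ` D m :: real set) \<in> sets borel" by (rule sets.countable[rotated]) simp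
    then have "rademacher_walk \<epsilon> a m -` (of_int ` D m) \<inter> space M \<in> events"
      by (rule measurable_sets[OF measurable_walk])
    moreover have "rademacher_walk \<epsilon> a m -` (of_int ` D m) \<inter> space M
        = {\<omega> \<in> space M. rademacher_walk \<epsilon> a m \<omega> \<in> of_int ` D m}" by blast
    ultimately show ?thesis by simp
  qed
  then show ?thesis unfolding stays_def by (rule sets.sets_Collect_finite_All) simp_all
qed

lemma walk_on_cylinder:
  assumes "\<omega> \<in> cylinder n \<sigma>"
  shows "rademacher_walk \<epsilon> (\<lambda>k. of_int (b (k - 1))) n \<omega> = of_int (\<Sum>k=1..n. \<sigma> k * b (k - 1))"
proof -
  have "\<epsilon> k \<omega> = of_int (\<sigma> k)" if "k \<in> {1..n}" for k
    using assms that unfolding cylinder_def by blast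
  then show ?thesis by (simp add: rademacher_walk_def)
qed

text \<open>
  On a cylinder of length \<open>n\<close> the position at time \<open>n\<close> is known, and the cylinder splits, up to a
  null set, into two cylinders of length \<open>n + 1\<close>, each with half its probability. This is the recursion that
  defines the killed walk. The shift in \<open>b (k - 1)\<close> is due to the sign with index \<open>k\<close> governing the move
  from time \<open>k - 1\<close> to time \<open>k\<close>.
\<close>
lemma prob_stays_le:
  fixes b :: "nat \<Rightarrow> int"
  assumes "\<And>i. i \<ge> 1 \<Longrightarrow> \<sigma> i = 1 \<or> \<sigma> i = -1"
  shows "prob (cylinder n \<sigma> \<inter> stays (\<lambda>k. of_int (b (k - 1))) D n j)
    \<le> (1 / 2) ^ n * killed b D j n (\<lambda>_. 1) (\<Sum>k=1..n. \<sigma> k * b (k - 1))"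
  using assms
proof (induction j arbitrary: n \<sigma>)
  case 0
  have "prob (cylinder n \<sigma> \<inter> stays (\<lambda>k. of_int (b (k - 1))) D n 0) \<le> prob (cylinder n \<sigma>)"
    by (intro finite_measure_mono) auto
  then show ?case using prob_cylinder[OF 0] by simp
next
  case (Suc j)
  let ?a = "\<lambda>k. of_int (b (k - 1)) :: real"
  let ?x = "\<Sum>k=1..n. \<sigma> k * b (k - 1)"
  show ?case
  proof (cases "?x \<in> D n")
    case False
    have "cylinder n \<sigma> \<inter> stays ?a D n (Suc j) = {}"
    proof (rule ccontr)
      assume "\<not> ?thesis"
      then obtain \<omega> where \<omega>: "\<omega> \<in> cylinder n \<sigma>" "\<omega> \<in> stays ?a D n (Suc j)" by blast
      from \<omega>(2) have "rademacher_walk \<epsilon> ?a n \<omega> \<in> of_int ` D n"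
        unfolding stays_def by simp
      then show False using walk_on_cylinder[OF \<omega>(1), of b] False by (auto simp del: of_int_sum)
    qed
    then show ?thesis using False by simp
  next
    case True
    define \<tau> where "\<tau> s = \<sigma>(Suc n := s)" for s :: int
    have x: "(\<Sum>k=1..Suc n. \<tau> s k * b (k - 1)) = ?x + s * b n" for s
    proof -
      have "(\<Sum>k=1..n. \<tau> s k * b (k - 1)) = ?x" by (intro sum.cong) (auto simp: \<tau>_def)
      then show ?thesis by (simp add: \<tau>_def)
    qed
    have IH: "prob (cylinder (Suc n) (\<tau> s) \<inter> stays ?a D (Suc n) j)
        \<le> (1 / 2) ^ Suc n * killed b D j (Suc n) (\<lambda>_. 1) (?x + s * b n)" if "s = 1 \<or> s = -1" for s
      unfolding x[symmetric] by (rule Suc.IH) (use Suc.prems that in \<open>auto simp: \<tau>_def\<close>)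
    have "prob (cylinder n \<sigma> \<inter> stays ?a D n (Suc j))
        \<le> prob ((cylinder (Suc n) (\<tau> 1) \<inter> stays ?a D (Suc n) j) \<union> (cylinder (Suc n) (\<tau> (-1)) \<inter> stays ?a D (Suc n) j))"
    proof (rule finite_measure_mono_AE)
      show "AE \<omega> in M. \<omega> \<in> cylinder n \<sigma> \<inter> stays ?a D n (Suc j) \<longrightarrow>
        \<omega> \<in> (cylinder (Suc n) (\<tau> 1) \<inter> stays ?a D (Suc n) j) \<union> (cylinder (Suc n) (\<tau> (-1)) \<inter> stays ?a D (Suc n) j)"
        using AE_sign
      proof eventually_elim
        case (elim \<omega>)
        then have sign: "\<epsilon> (Suc n) \<omega> = 1 \<or> \<epsilon> (Suc n) \<omega> = -1" by simp
        show ?case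
        proof
          assume \<omega>: "\<omega> \<in> cylinder n \<sigma> \<inter> stays ?a D n (Suc j)"
          have "\<omega> \<in> cylinder (Suc n) (\<tau> s)" if "\<epsilon> (Suc n) \<omega> = of_int s" for s
            using \<omega> that by (auto simp: cylinder_def \<tau>_def le_Suc_eq)
          from this[of 1] this[of "-1"] sign
          have "\<omega> \<in> cylinder (Suc n) (\<tau> 1) \<union> cylinder (Suc n) (\<tau> (-1))" by auto
          moreover have "\<omega> \<in> stays ?a D (Suc n) j" using \<omega> by (simp add: stays_def)
          ultimately show "\<omega> \<in> (cylinder (Suc n) (\<tau> 1) \<inter> stays ?a D (Suc n) j) \<union> (cylinder (Suc n) (\<tau> (-1)) \<inter> stays ?a D (Suc n) j)"
            by blast
        qed
      qed
    qed auto
    also have "\<dots> \<le> prob (cylinder (Suc n) (\<tau> 1) \<inter> stays ?a D (Suc n) j)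
        + prob (cylinder (Suc n) (\<tau> (-1)) \<inter> stays ?a D (Suc n) j)"
      by (intro measure_Un_le) auto
    also have "\<dots> \<le> (1 / 2) ^ n * killed b D (Suc j) n (\<lambda>_. 1) ?x"
    proof -
      have "(1 / 2) ^ n * killed b D (Suc j) n (\<lambda>_. 1) ?x
          = (1 / 2) ^ Suc n * killed b D j (Suc n) (\<lambda>_. 1) (?x + 1 * b n)
          + (1 / 2) ^ Suc n * killed b D j (Suc n) (\<lambda>_. 1) (?x + - 1 * b n)"
        unfolding killed.simps using True by (simp add: algebra_simps)
      then show ?thesis using IH[of 1] IH[of "-1"] by linarith
    qed
    finally show ?thesis .
  qed
qed

lemma prob_stays_0_le:
  "prob (stays (\<lambda>k. of_int (b (k - 1))) D 0 j) \<le> killed b D j 0 (\<lambda>_. 1) 0"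
proof -
  have "cylinder 0 (\<lambda>_. 1) \<inter> stays (\<lambda>k. of_int (b (k - 1))) D 0 j = stays (\<lambda>k. of_int (b (k - 1))) D 0 j"
    by (auto simp: cylinder_def stays_def)
  then show ?thesis using prob_stays_le[of "\<lambda>_. 1" 0 b D j] by simp
qed

text \<open>
  Avoiding \<open>0\<close> at all times from \<open>N\<close> on is contained in surviving up to time \<open>4 ^ k\<close>, for
  every \<open>k\<close>.
\<close>
lemma AE_hits_zero:
  "AE \<omega> in M. \<exists>n\<ge>N. rademacher_walk \<epsilon> (\<lambda>k. real (step_size (k - 1))) n \<omega> = 0"
proof -
  let ?X = "rademacher_walk \<epsilon> (\<lambda>k. real (step_size (k - 1)))"
  have [measurable]: "{\<omega> \<in> space M. \<forall>n\<ge>N. ?X n \<omega> \<noteq> 0} \<in> events" (is "?E \<in> _") by measurable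
  have "prob ?E \<le> 0"
  proof (rule field_le_epsilon)
    fix e :: real assume "e > 0"
    then obtain k where k: "survival N (4 ^ k) \<le> e" using survival_small by blast
    have "prob ?E \<le> prob (stays (\<lambda>k. of_int (walk_step (k - 1))) (alive N) 0 (4 ^ k))"
    proof (rule finite_measure_mono_AE)
      show "AE \<omega> in M. \<omega> \<in> ?E \<longrightarrow> \<omega> \<in> stays (\<lambda>k. of_int (walk_step (k - 1))) (alive N) 0 (4 ^ k)"
        using AE_sign
      proof eventually_elim
        case (elim \<omega>)
        have "?X m \<omega> \<in> \<int>" for m
          unfolding rademacher_walk_def
        proof (intro Ints_sum Ints_mult)
          fix k assume "k \<in> {1..m}"
          then show "\<epsilon> k \<omega> \<in> \<int>" using elim by auto
        qed auto
        then have X: "\<exists>y. ?X m \<omega> = of_int y" for m by (auto elim: Ints_cases)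
        show ?case
        proof
          assume E: "\<omega> \<in> ?E"
          have "?X m \<omega> \<in> of_int ` alive N m" for m
          proof -
            obtain y where "?X m \<omega> = of_int y" using X by blast
            moreover have "y \<in> alive N m" using E calculation by (auto simp: alive_def)
            ultimately show ?thesis by auto
          qed
          then show "\<omega> \<in> stays (\<lambda>k. of_int (walk_step (k - 1))) (alive N) 0 (4 ^ k)"
            using E by (auto simp: stays_def)
        qed
      qed
    qed auto
    also have "\<dots> \<le> survival N (4 ^ k)" unfolding survival_def by (rule prob_stays_0_le)
    finally show "prob ?E \<le> 0 + e" using k by simp
  qed
  then have "prob ?E = 0" using measure_nonneg[of M ?E] by linarith
  then have "AE \<omega> in M. \<not> (\<forall>n\<ge>N. ?X n \<omega> \<noteq> 0)"
    by (subst (asm) prob_Collect_eq_0) auto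
  then show ?thesis by eventually_elim auto
qed

lemma weakly_recurrent_walk:
  "weakly_recurrent M (rademacher_walk \<epsilon> (\<lambda>k. real (step_size (k - 1))))"
proof -
  let ?X = "rademacher_walk \<epsilon> (\<lambda>k. real (step_size (k - 1)))"
  have "AE \<omega> in M. \<forall>N. \<exists>n\<ge>N. ?X n \<omega> = 0"
    using AE_hits_zero by (simp add: AE_all_countable)
  then have "AE \<omega> in M. \<exists>C::real. \<exists>\<^sub>\<infinity>n. \<bar>?X n \<omega>\<bar> \<le> C"
  proof eventually_elim
    case (elim \<omega>)
    then have "\<exists>\<^sub>\<infinity>n. \<bar>?X n \<omega>\<bar> \<le> 0" by (auto simp: INFM_nat_le)
    then show ?case by blast
  qed
  moreover have "{\<omega> \<in> space M. \<exists>C::real. \<exists>\<^sub>\<infinity>n. \<bar>?X n \<omega>\<bar> \<le> C} \<in> events"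
  proof -
    have "(\<exists>C::real. \<exists>\<^sub>\<infinity>n. \<bar>?X n \<omega>\<bar> \<le> C) \<longleftrightarrow> (\<exists>C::nat. \<forall>N. \<exists>n\<ge>N. \<bar>?X n \<omega>\<bar> \<le> real C)" for \<omega>
    proof
      assume "\<exists>C::real. \<exists>\<^sub>\<infinity>n. \<bar>?X n \<omega>\<bar> \<le> C"
      then obtain C where C: "\<exists>\<^sub>\<infinity>n. \<bar>?X n \<omega>\<bar> \<le> C" by blast
      obtain c :: nat where "C \<le> real c" using real_arch_simple by blast
      then show "\<exists>C::nat. \<forall>N. \<exists>n\<ge>N. \<bar>?X n \<omega>\<bar> \<le> real C"
        using C unfolding INFM_nat_le by (meson order_trans)
    qed (auto simp: INFM_nat_le)
    then show ?thesis by (simp only:) measurable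
  qed
  ultimately show ?thesis
    unfolding weakly_recurrent_def by (subst prob_Collect_eq_1) auto
qed

end

lemma step_size_Theta: "(\<lambda>n. real (step_size (n - 1))) \<in> \<Theta>(\<lambda>n. sqrt (real n))"
proof (rule bigthetaI)
  have ev: "eventually (\<lambda>n::nat. n \<ge> 2) at_top" by (rule eventually_ge_at_top)
  show "(\<lambda>n. real (step_size (n - 1))) \<in> O(\<lambda>n. sqrt (real n))"
  proof (rule bigoI[of _ 2], use ev in eventually_elim)
    case (elim n)
    have "(step_size (n - 1))\<^sup>2 \<le> 4 * n" using step_size_bounds(2)[of "n - 1"] elim by linarith
    then have "real ((step_size (n - 1))\<^sup>2) \<le> real (4 * n)" by (simp only: of_nat_le_iff)
    then have "real (step_size (n - 1)) \<le> sqrt (4 * real n)" by (intro real_le_rsqrt) simp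
    then show ?case by (simp add: real_sqrt_mult)
  qed
  show "(\<lambda>n. real (step_size (n - 1))) \<in> \<Omega>(\<lambda>n. sqrt (real n))"
  proof (rule landau_omega.bigI[of "1 / 3"], simp, use ev in eventually_elim)
    case (elim n)
    have "n < 9 * (step_size (n - 1))\<^sup>2" using step_size_bounds(1)[of "n - 1"] elim by linarith
    then have "real n \<le> real (9 * (step_size (n - 1))\<^sup>2)" by (simp only: of_nat_le_iff)
    then have "sqrt (real n) \<le> 3 * real (step_size (n - 1))"
      by (intro real_le_lsqrt) (auto simp: power_mult_distrib)
    then show ?case by simp
  qed
qed

theorem theorem2:
  shows "\<exists>a :: nat \<Rightarrow> nat.
    (\<lambda>n. real (a n)) \<in> \<Theta>(\<lambda>n. sqrt (real n)) \<and>
    (\<forall>(M :: 'w measure) \<epsilon>. rademacher_sequence M \<epsilon> \<longrightarrow>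
       weakly_recurrent M (rademacher_walk \<epsilon> (\<lambda>n. real (a n))))"
proof (intro exI conjI allI impI)
  show "(\<lambda>n. real (step_size (n - 1))) \<in> \<Theta>(\<lambda>n. sqrt (real n))" by (rule step_size_Theta)
  fix M :: "'w measure" and \<epsilon> :: "nat \<Rightarrow> 'w \<Rightarrow> real"
  assume "rademacher_sequence M \<epsilon>"
  then interpret rademacher_sequence M \<epsilon> .
  show "weakly_recurrent M (rademacher_walk \<epsilon> (\<lambda>n. real (step_size (n - 1))))"
    by (rule weakly_recurrent_walk)
qed

end
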